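(* Let $\mathbb{F}$ be a field, $E\neq0$ a vector space over $\mathbb{F}$ with a symmetric bilinear form $b\colon E\times E\to\mathbb{F}$, and $\alpha\in\mathbb{F}$ with $\alpha\notin\{0,1\}$ and $\alpha\neq\frac12$ (i.e. $2\alpha\neq1$). The split spin factor algebra $A=S(b,\alpha)$ is a primitive axial algebra of Monster type $(\alpha,\frac12)$ if and only if $\mathrm{char}(\mathbb{F})\neq2$, $\alpha\neq-1$ and $E$ is spanned by vectors $e$ with $b(e,e)=1$.
   Context: Algebras are commutative, not necessarily associative. The split spin factor $S(b,\alpha)$ is the commutative algebra on the vector space $E\oplus\mathbb{F}z_1\oplus\mathbb{F}z_2$ with multiplication $z_1^2=z_1$, $z_2^2=z_2$, $z_1z_2=0$, $ez_1=\alpha e$, $ez_2=(1-\alpha)e$, $ef=-b(e,f)z$ for all $e,f\in E$, where $z:=\alpha(\alpha-2)z_1+(\alpha-1)(\alpha+1)z_2$. For $a\in A$ and $\lambda\in\mathbb{F}$ put $A_\lambda(a)=\{v\in A: av=\lambda v\}$ (possibly zero), and for $N\subseteq\mathbb{F}$ put $A_N(a)=\bigoplus_{\nu\in N}A_\nu(a)$. For a fusion law $\mathcal{F}\subseteq\mathbb{F}$ with $1\in\mathcal{F}$ and symmetric map $\ast\colon\mathcal{F}\times\mathcal{F}\to2^{\mathcal{F}}$, an $\mathcal{F}$-axis is a non-zero idempotent $a\in A$ such that $A=\bigoplus_{\lambda\in\mathcal{F}}A_\lambda(a)$ and $A_\lambda(a)A_\mu(a)\subseteq A_{\lambda\ast\mu}(a)$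 for all $\lambda,\mu\in\mathcal{F}$. It is primitive if $A_1(a)=\mathbb{F}a$. The fusion law of Monster type $(\alpha,\beta)$ is the symmetric law on $\{1,0,\alpha,\beta\}$ with $1\ast1=\{1\}$, $1\ast0=\emptyset$, $0\ast0=\{0\}$, $1\ast\alpha=0\ast\alpha=\{\alpha\}$, $\alpha\ast\alpha=\{1,0\}$, $1\ast\beta=0\ast\beta=\alpha\ast\beta=\{\beta\}$, $\beta\ast\beta=\{1,0,\alpha\}$; it presupposes that $1,0,\alpha,\beta$ are four distinct elements of $\mathbb{F}$ (so Monster type $(\alpha,\frac12)$ does not occur in characteristic $2$). $A$ is a primitive axial algebra of Monster type $(\alpha,\beta)$ if it is generated as an algebra by some set of primitive $\mathcal{F}$-axes for this law $\mathcal{F}$. *)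

theory Defs
  imports Complex_Main "HOL-Analysis.Product_Vector"
begin

section \<open>Fusion laws\<close>

definition fusion_law :: "'a::field set \<Rightarrow> ('a \<Rightarrow> 'a \<Rightarrow> 'a set) \<Rightarrow> bool" where
  "fusion_law F star \<longleftrightarrow> 1 \<in> F \<and>
     (\<forall>x\<in>F. \<forall>y\<in>F. star x y \<subseteq> F \<and> star x y = star y x)"

definition monster_set :: "'a::field \<Rightarrow> 'a \<Rightarrow> 'a set" where
  "monster_set \<alpha> \<beta> = {1, 0, \<alpha>, \<beta>}"

text \<open>Comparing the unordered pair \<open>{x, y}\<close> makes the law symmetric. Only the values at
  elements of \<^term>\<open>monster_set \<alpha> \<beta>\<close> matter, and the table is only meaningful when
  \<open>1, 0, \<alpha>, \<beta>\<close> are distinct.\<close>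

definition monster_star :: "'a::field \<Rightarrow> 'a \<Rightarrow> 'a \<Rightarrow> 'a \<Rightarrow> 'a set" where
  "monster_star \<alpha> \<beta> x y =
    (if {x, y} = {1} then {1}
     else if {x, y} = {1, 0} then {}
     else if {x, y} = {0} then {0}
     else if {x, y} = {1, \<alpha>} \<or> {x, y} = {0, \<alpha>} then {\<alpha>}
     else if {x, y} = {\<alpha>} then {1, 0}
     else if {x, y} = {1, \<beta>} \<or> {x, y} = {0, \<beta>} \<or> {x, y} = {\<alpha>, \<beta>} then {\<beta>}
     else if {x, y} = {\<beta>} then {1, 0, \<alpha>}
     else {})"

lemma fusion_law_monster: "fusion_law (monster_set \<alpha> \<beta>) (monster_star \<alpha> \<beta>)"
proof -
  have "monster_star \<alpha> \<beta> x y = monster_star \<alpha> \<beta> y x" for x y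
    unfolding monster_star_def by (simp add: insert_commute)
  moreover have "monster_star \<alpha> \<beta> x y \<subseteq> monster_set \<alpha> \<beta>" for x y
    unfolding monster_star_def monster_set_def by simp
  ultimately show ?thesis
    by (auto simp: fusion_law_def monster_set_def)
qed

lemma monster_star_table:
  assumes "distinct [1, 0, \<alpha>, \<beta>]"
  shows "monster_star \<alpha> \<beta> 1 1 = {1}" "monster_star \<alpha> \<beta> 1 0 = {}" "monster_star \<alpha> \<beta> 0 0 = {0}"
    "monster_star \<alpha> \<beta> 1 \<alpha> = {\<alpha>}" "monster_star \<alpha> \<beta> 0 \<alpha> = {\<alpha>}" "monster_star \<alpha> \<beta> \<alpha> \<alpha> = {1, 0}"
    "monster_star \<alpha> \<beta> 1 \<beta> = {\<beta>}" "monster_star \<alpha> \<beta> 0 \<beta> = {\<beta>}" "monster_star \<alpha> \<beta> \<alpha> \<beta> = {\<beta>}"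
    "monster_star \<alpha> \<beta> \<beta> \<beta> = {1, 0, \<alpha>}"
  using assms by (auto simp: monster_star_def doubleton_eq_iff)


section \<open>Axial algebras\<close>

text \<open>Algebras are commutative, but neither associativity nor a unit is assumed.\<close>

locale commutative_algebra = vector_space scale
  for scale :: "'a::field \<Rightarrow> 'v::ab_group_add \<Rightarrow> 'v" (infixr \<open>*s\<close> 75) +
  fixes mult :: "'v \<Rightarrow> 'v \<Rightarrow> 'v" (infixl \<open>\<bullet>\<close> 70)
  assumes mult_commute: "x \<bullet> y = y \<bullet> x"
    and mult_add_left: "(x + y) \<bullet> w = x \<bullet> w + y \<bullet> w"
    and mult_scale_left: "(c *s x) \<bullet> y = c *s (x \<bullet> y)"
begin

definition eigenspace :: "'v \<Rightarrow> 'a \<Rightarrow> 'v set" where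
  "eigenspace a \<nu> = {v. a \<bullet> v = \<nu> *s v}"

text \<open>The sum of the eigenspaces for eigenvalues in \<open>N\<close>; sums of eigenspaces for distinct
  eigenvalues are always direct.\<close>

definition eigenspace_sum :: "'v \<Rightarrow> 'a set \<Rightarrow> 'v set" where
  "eigenspace_sum a N = span (\<Union>\<nu>\<in>N. eigenspace a \<nu>)"

definition is_direct_sum :: "'i set \<Rightarrow> ('i \<Rightarrow> 'v set) \<Rightarrow> bool" where
  "is_direct_sum I U \<longleftrightarrow> span (\<Union>i\<in>I. U i) = UNIV \<and>
     (\<forall>J u. finite J \<and> J \<subseteq> I \<and> (\<forall>i\<in>J. u i \<in> U i) \<and> (\<Sum>i\<in>J. u i) = 0 \<longrightarrow> (\<forall>i\<in>J. u i = 0))"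

definition is_axis :: "'a set \<Rightarrow> ('a \<Rightarrow> 'a \<Rightarrow> 'a set) \<Rightarrow> 'v \<Rightarrow> bool" where
  "is_axis F star a \<longleftrightarrow> a \<noteq> 0 \<and> a \<bullet> a = a \<and> is_direct_sum F (eigenspace a) \<and>
     (\<forall>x\<in>F. \<forall>y\<in>F. \<forall>u\<in>eigenspace a x. \<forall>v\<in>eigenspace a y. u \<bullet> v \<in> eigenspace_sum a (star x y))"

definition is_primitive_axis :: "'a set \<Rightarrow> ('a \<Rightarrow> 'a \<Rightarrow> 'a set) \<Rightarrow> 'v \<Rightarrow> bool" where
  "is_primitive_axis F star a \<longleftrightarrow> is_axis F star a \<and> eigenspace a 1 = span {a}"

definition subalgebra :: "'v set \<Rightarrow> bool" where
  "subalgebra S \<longleftrightarrow> subspace S \<and> (\<forall>x\<in>S. \<forall>y\<in>S. x \<bullet> y \<in> S)"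

definition is_primitive_axial_algebra :: "'a set \<Rightarrow> ('a \<Rightarrow> 'a \<Rightarrow> 'a set) \<Rightarrow> bool" where
  "is_primitive_axial_algebra F star \<longleftrightarrow>
     (\<exists>X. (\<forall>a\<in>X. is_primitive_axis F star a) \<and> subalgebra hull X = UNIV)"

text \<open>The distinctness condition is part of the notion. In particular type \<open>(\<alpha>, 1/2)\<close> does
  not occur in characteristic 2, where \<open>1/2 = 0\<close> by the convention for division by zero.\<close>

definition is_primitive_axial_algebra_of_monster_type :: "'a \<Rightarrow> 'a \<Rightarrow> bool" where
  "is_primitive_axial_algebra_of_monster_type \<alpha> \<beta> \<longleftrightarrow> distinct [1, 0, \<alpha>, \<beta>] \<and>
     is_primitive_axial_algebra (monster_set \<alpha> \<beta>) (monster_star \<alpha> \<beta>)"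

end


section \<open>The split spin factor\<close>

definition symmetric_bilinear ::
    "('a::field \<Rightarrow> 'e::ab_group_add \<Rightarrow> 'e) \<Rightarrow> ('e \<Rightarrow> 'e \<Rightarrow> 'a) \<Rightarrow> bool" where
  "symmetric_bilinear s b \<longleftrightarrow> (\<forall>e f. b e f = b f e) \<and>
     (\<forall>e. Vector_Spaces.linear s (*) (\<lambda>f. b e f)) \<and> (\<forall>f. Vector_Spaces.linear s (*) (\<lambda>e. b e f))"

text \<open>The triple \<open>(e, x, y)\<close> stands for \<open>e + x z\<^sub>1 + y z\<^sub>2\<close>; the space carries the
  product vector space structure.\<close>

abbreviation ssf_scale ::
    "('a::field \<Rightarrow> 'e::ab_group_add \<Rightarrow> 'e) \<Rightarrow> 'a \<Rightarrow> 'e \<times> 'a \<times> 'a \<Rightarrow> 'e \<times> 'a \<times> 'a" where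
  "ssf_scale s \<equiv> module_prod.scale s (module_prod.scale (*) (*))"

lemma vector_space_ssf:
  fixes s :: "'a::field \<Rightarrow> 'e::ab_group_add \<Rightarrow> 'e"
  assumes "vector_space s"
  shows "vector_space (ssf_scale s)" and "ssf_scale s c (e, x, y) = (s c e, c * x, c * y)"
proof -
  interpret vector_space s by fact
  interpret F: vector_space "(*) :: 'a \<Rightarrow> 'a \<Rightarrow> 'a"
    by unfold_locales (auto simp: algebra_simps)
  interpret FF: vector_space_prod "(*) :: 'a \<Rightarrow> 'a \<Rightarrow> 'a" "(*) :: 'a \<Rightarrow> 'a \<Rightarrow> 'a" ..
  interpret vector_space_prod s FF.scale ..
  show "vector_space (ssf_scale s)" ..
  show "ssf_scale s c (e, x, y) = (s c e, c * x, c * y)"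
    by (simp add: scale_prod FF.scale_prod)
qed

definition ssf_mult ::
    "('a::field \<Rightarrow> 'e::ab_group_add \<Rightarrow> 'e) \<Rightarrow> ('e \<Rightarrow> 'e \<Rightarrow> 'a) \<Rightarrow> 'a \<Rightarrow>
       'e \<times> 'a \<times> 'a \<Rightarrow> 'e \<times> 'a \<times> 'a \<Rightarrow> 'e \<times> 'a \<times> 'a" where
  "ssf_mult s b \<alpha> = (\<lambda>(e, x\<^sub>1, x\<^sub>2) (f, y\<^sub>1, y\<^sub>2).
     (s (\<alpha> * y\<^sub>1 + (1 - \<alpha>) * y\<^sub>2) e + s (\<alpha> * x\<^sub>1 + (1 - \<alpha>) * x\<^sub>2) f,
      x\<^sub>1 * y\<^sub>1 - b e f * (\<alpha> * (\<alpha> - 2)),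
      x\<^sub>2 * y\<^sub>2 - b e f * ((\<alpha> - 1) * (\<alpha> + 1))))"

lemma ssf_mult_relations:
  fixes s :: "'a::field \<Rightarrow> 'e::ab_group_add \<Rightarrow> 'e" and \<alpha> :: 'a
  assumes "vector_space s" and "symmetric_bilinear s b"
  defines "z\<^sub>1 \<equiv> (0, 1, 0)" and "z\<^sub>2 \<equiv> (0, 0, 1)"
  defines "z \<equiv> ssf_scale s (\<alpha> * (\<alpha> - 2)) z\<^sub>1 + ssf_scale s ((\<alpha> - 1) * (\<alpha> + 1)) z\<^sub>2"
  shows "ssf_mult s b \<alpha> z\<^sub>1 z\<^sub>1 = z\<^sub>1" "ssf_mult s b \<alpha> z\<^sub>2 z\<^sub>2 = z\<^sub>2" "ssf_mult s b \<alpha> z\<^sub>1 z\<^sub>2 = 0"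
    "ssf_mult s b \<alpha> (e, 0, 0) z\<^sub>1 = ssf_scale s \<alpha> (e, 0, 0)"
    "ssf_mult s b \<alpha> (e, 0, 0) z\<^sub>2 = ssf_scale s (1 - \<alpha>) (e, 0, 0)"
    "ssf_mult s b \<alpha> (e, 0, 0) (f, 0, 0) = ssf_scale s (- b e f) z"
proof -
  interpret vector_space s by fact
  have scl: "b (s c e) f = c * b e f" "b e (s c f) = c * b e f" for c e f
    using assms(2) by (simp_all add: symmetric_bilinear_def Vector_Spaces.linear_iff)
  have [simp]: "b 0 f = 0" "b e 0 = 0" for e f
    using scl(1)[of 0 0 f] scl(2)[of e 0 0] by simp_all
  show "ssf_mult s b \<alpha> z\<^sub>1 z\<^sub>1 = z\<^sub>1" "ssf_mult s b \<alpha> z\<^sub>2 z\<^sub>2 = z\<^sub>2" "ssf_mult s b \<alpha> z\<^sub>1 z\<^sub>2 = 0"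
    "ssf_mult s b \<alpha> (e, 0, 0) z\<^sub>1 = ssf_scale s \<alpha> (e, 0, 0)"
    "ssf_mult s b \<alpha> (e, 0, 0) z\<^sub>2 = ssf_scale s (1 - \<alpha>) (e, 0, 0)"
    "ssf_mult s b \<alpha> (e, 0, 0) (f, 0, 0) = ssf_scale s (- b e f) z"
    unfolding z_def z\<^sub>1_def z\<^sub>2_def
    by (simp_all add: ssf_mult_def vector_space_ssf(2)[OF assms(1)] zero_prod_def)
qed

lemma commutative_algebra_ssf:
  fixes s :: "'a::field \<Rightarrow> 'e::ab_group_add \<Rightarrow> 'e"
  assumes "vector_space s" and "symmetric_bilinear s b"
  shows "commutative_algebra (ssf_scale s) (ssf_mult s b \<alpha>)"
proof -
  interpret vector_space s by fact
  have sym: "b e f = b f e" for e f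
    using assms(2) by (simp add: symmetric_bilinear_def)
  have lin: "Vector_Spaces.linear s (*) (\<lambda>e. b e f)" for f
    using assms(2) by (simp add: symmetric_bilinear_def)
  have add: "b (e + e') f = b e f + b e' f" for e e' f
    using lin[of f] by (simp add: Vector_Spaces.linear_iff)
  have scl: "b (s c e) f = c * b e f" for c e f
    using lin[of f] by (simp add: Vector_Spaces.linear_iff)
  interpret A: vector_space "ssf_scale s"
    using assms(1) by (rule vector_space_ssf(1))
  note scale = vector_space_ssf(2)[OF assms(1)]
  show ?thesis
  proof
    show "ssf_mult s b \<alpha> x y = ssf_mult s b \<alpha> y x" for x y
      by (cases x; cases y) (simp add: ssf_mult_def sym mult.commute add.commute)
    show "ssf_mult s b \<alpha> (x + y) w = ssf_mult s b \<alpha> x w + ssf_mult s b \<alpha> y w" for x y w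
      by (cases x; cases y; cases w) (simp add: ssf_mult_def add algebra_simps)
    show "ssf_mult s b \<alpha> (ssf_scale s c x) y = ssf_scale s c (ssf_mult s b \<alpha> x y)" for c x y
      by (cases x; cases y) (simp add: ssf_mult_def scale scl algebra_simps)
  qed
qed

end

theory Submission
  imports Defs
begin

text \<open>The algebra has the unit \<open>z\<^sub>1 + z\<^sub>2\<close>, and outside characteristic 2 its idempotents can
  be listed (\<open>idempotent_cases\<close>): besides \<open>0\<close>, \<open>z\<^sub>1\<close>, \<open>z\<^sub>2\<close> and the unit there are only
  \<open>(f + \<alpha> z\<^sub>1 + (1 + \<alpha>) z\<^sub>2) / 2\<close> with \<open>b f f = 1\<close>, called \<open>half_axis f\<close> below, and
  their complements \<open>1 - half_axis f\<close>. On the span of \<open>f, z\<^sub>1, z\<^sub>2\<close> the idempotent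
  \<open>half_axis f\<close> has the eigenvalues \<open>1, 0, \<alpha>\<close>, and it acts as \<open>1 / 2\<close> on the orthogonal
  complement of \<open>f\<close> in \<open>E\<close>. The fusion law then holds by direct computation
  (\<open>primitive_axis_half_axis\<close>), and likewise for \<open>z\<^sub>1\<close>, which has no eigenvalue \<open>1 / 2\<close>.
  The idempotents \<open>z\<^sub>2\<close> and \<open>1 - half_axis f\<close> have the eigenvalue \<open>1 - \<alpha>\<close>, which is not in
  the fusion law, and the unit is not primitive. So the primitive axes are exactly \<open>z\<^sub>1\<close> and the
  \<open>half_axis f\<close>; \<open>primitive_axis_cases\<close> is the part of this that excludes all others.

  It remains to see what these axes generate. They all lie in \<open>E\<^sub>0 + \<langle>z\<^sub>1, z\<^sub>2\<rangle>\<close>, where \<open>E\<^sub>0\<close> is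
  the span of the vectors \<open>f\<close> with \<open>b f f = 1\<close>, and if \<open>\<alpha> = - 1\<close> they lie in
  \<open>E + \<langle>z\<^sub>1\<rangle>\<close>; both subspaces are subalgebras, so the conditions are necessary.
  Conversely \<open>z\<^sub>1 \<bullet> half_axis f = (\<alpha> / 2) (f + z\<^sub>1)\<close> gives \<open>f\<close>, hence all of \<open>E\<close>, and then
  \<open>half_axis f\<close> gives \<open>(1 + \<alpha>) z\<^sub>2\<close>. Characteristic 2 is excluded because there
  \<open>1 / 2 = 0\<close>, against the distinctness of the eigenvalues.\<close>

section \<open>Eigenspaces and axes in commutative algebras\<close>

context commutative_algebra
begin

lemma mult_add_right: "w \<bullet> (x + y) = w \<bullet> x + w \<bullet> y"
  by (metis mult_commute mult_add_left)

lemma mult_scale_right: "x \<bullet> (c *s y) = c *s (x \<bullet> y)"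
  by (metis mult_commute mult_scale_left)

lemma mult_zero_right [simp]: "x \<bullet> 0 = 0"
  using mult_scale_right[of x 0 0] by simp

lemma mult_diff_right: "w \<bullet> (x - y) = w \<bullet> x - w \<bullet> y"
  by (metis add_diff_cancel diff_add_cancel mult_add_right)

lemma mult_diff_left: "(x - y) \<bullet> w = x \<bullet> w - y \<bullet> w"
  by (metis mult_commute mult_diff_right)

lemma mult_sum_right: "x \<bullet> (\<Sum>i\<in>J. u i) = (\<Sum>i\<in>J. x \<bullet> u i)"
  by (induction J rule: infinite_finite_induct) (simp_all add: mult_add_right)

lemma subspace_eigenspace: "subspace (eigenspace a \<nu>)"
  by (auto simp: subspace_def eigenspace_def mult_add_right mult_scale_right scale_right_distrib
      mult.commute)

lemma eigenvectors_independent: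
  assumes "finite J" and "\<forall>\<nu>\<in>J. u \<nu> \<in> eigenspace a \<nu>" and "(\<Sum>\<nu>\<in>J. u \<nu>) = 0"
  shows "\<forall>\<nu>\<in>J. u \<nu> = 0"
  using assms
proof (induction J arbitrary: u rule: finite_induct)
  case empty
  then show ?case by simp
next
  case (insert \<mu> J)
  have sum0: "u \<mu> + (\<Sum>\<nu>\<in>J. u \<nu>) = 0"
    using insert.hyps insert.prems(2) by simp
  \<comment> \<open>Applying multiplication by \<open>a\<close>, minus \<open>\<mu>\<close>, removes the term \<open>u \<mu>\<close>.\<close>
  have "a \<bullet> (u \<mu> + (\<Sum>\<nu>\<in>J. u \<nu>)) = \<mu> *s u \<mu> + (\<Sum>\<nu>\<in>J. \<nu> *s u \<nu>)"
    using insert.prems(1) by (auto simp: mult_add_right mult_sum_right eigenspace_def)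
  then have "\<mu> *s u \<mu> + (\<Sum>\<nu>\<in>J. \<nu> *s u \<nu>) = \<mu> *s (u \<mu> + (\<Sum>\<nu>\<in>J. u \<nu>))"
    using sum0 by simp
  then have "(\<Sum>\<nu>\<in>J. (\<nu> - \<mu>) *s u \<nu>) = 0"
    by (simp add: scale_right_distrib scale_sum_right scale_left_diff_distrib sum_subtractf)
  moreover have "\<forall>\<nu>\<in>J. (\<nu> - \<mu>) *s u \<nu> \<in> eigenspace a \<nu>"
    using insert.prems(1) subspace_eigenspace by (auto intro: subspace_scale)
  ultimately have "\<forall>\<nu>\<in>J. (\<nu> - \<mu>) *s u \<nu> = 0"
    using insert.IH[of "\<lambda>\<nu>. (\<nu> - \<mu>) *s u \<nu>"] by blast
  then have "\<forall>\<nu>\<in>J. u \<nu> = 0"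
    using insert.hyps(2) by auto
  then show ?case
    using sum0 by simp
qed

text \<open>Finiteness of \<open>N\<close> allows all summands to be indexed by \<open>N\<close> itself.\<close>

lemma eigenspace_sum_decomposition:
  assumes "finite N" and "v \<in> eigenspace_sum a N"
  shows "\<exists>u. (\<forall>\<nu>\<in>N. u \<nu> \<in> eigenspace a \<nu>) \<and> v = (\<Sum>\<nu>\<in>N. u \<nu>)"
proof -
  let ?S = "{v. \<exists>u. (\<forall>\<nu>\<in>N. u \<nu> \<in> eigenspace a \<nu>) \<and> v = (\<Sum>\<nu>\<in>N. u \<nu>)}"
  have "(\<Union>\<nu>\<in>N. eigenspace a \<nu>) \<subseteq> ?S"
  proof clarify
    fix \<nu> w
    assume "\<nu> \<in> N" "w \<in> eigenspace a \<nu>"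
    then show "\<exists>u. (\<forall>\<nu>\<in>N. u \<nu> \<in> eigenspace a \<nu>) \<and> w = (\<Sum>\<nu>\<in>N. u \<nu>)"
      using assms(1) subspace_0[OF subspace_eigenspace]
      by (intro exI[of _ "\<lambda>\<mu>. if \<mu> = \<nu> then w else 0"]) auto
  qed
  moreover have "subspace ?S"
  proof (rule subspaceI)
    show "0 \<in> ?S"
      using subspace_0[OF subspace_eigenspace] by (auto intro!: exI[of _ "\<lambda>_. 0"])
    show "x + y \<in> ?S" if "x \<in> ?S" "y \<in> ?S" for x y
    proof -
      from that obtain u u' where "\<forall>\<nu>\<in>N. u \<nu> \<in> eigenspace a \<nu>" "x = sum u N"
        "\<forall>\<nu>\<in>N. u' \<nu> \<in> eigenspace a \<nu>" "y = sum u' N"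
        by blast
      then show ?thesis
        using subspace_add[OF subspace_eigenspace]
        by (auto simp: sum.distrib intro!: exI[of _ "\<lambda>\<nu>. u \<nu> + u' \<nu>"])
    qed
    show "c *s x \<in> ?S" if "x \<in> ?S" for c x
    proof -
      from that obtain u where "\<forall>\<nu>\<in>N. u \<nu> \<in> eigenspace a \<nu>" "x = sum u N"
        by blast
      then show ?thesis
        using subspace_scale[OF subspace_eigenspace]
        by (auto simp: scale_sum_right intro!: exI[of _ "\<lambda>\<nu>. c *s u \<nu>"])
    qed
  qed
  ultimately have "span (\<Union>\<nu>\<in>N. eigenspace a \<nu>) \<subseteq> ?S"
    by (rule span_minimal)
  then show ?thesis
    using assms(2) unfolding eigenspace_sum_def by blast
qed

lemma axis_eigenvalue_mem:
  assumes "finite F" and "is_axis F star a" and "a \<bullet> v = \<mu> *s v" and "v \<noteq> 0"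
  shows "\<mu> \<in> F"
proof (rule ccontr)
  assume "\<mu> \<notin> F"
  have "v \<in> eigenspace_sum a F"
    using assms(2) by (simp add: is_axis_def is_direct_sum_def eigenspace_sum_def)
  then obtain u where u: "\<forall>\<nu>\<in>F. u \<nu> \<in> eigenspace a \<nu>" "v = (\<Sum>\<nu>\<in>F. u \<nu>)"
    using eigenspace_sum_decomposition[OF assms(1)] by blast
  define u' where "u' = u(\<mu> := - v)"
  have "- v \<in> eigenspace a \<mu>"
    using assms(3) subspace_neg[OF subspace_eigenspace] by (simp add: eigenspace_def)
  then have "\<forall>\<nu>\<in>insert \<mu> F. u' \<nu> \<in> eigenspace a \<nu>"
    using u(1) by (simp add: u'_def)
  moreover have "(\<Sum>\<nu>\<in>F. u' \<nu>) = (\<Sum>\<nu>\<in>F. u \<nu>)"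
    using \<open>\<mu> \<notin> F\<close> by (intro sum.cong) (auto simp: u'_def)
  then have "(\<Sum>\<nu>\<in>insert \<mu> F. u' \<nu>) = 0"
    using \<open>\<mu> \<notin> F\<close> assms(1) u(2) by (simp add: u'_def)
  ultimately have "\<forall>\<nu>\<in>insert \<mu> F. u' \<nu> = 0"
    using eigenvectors_independent assms(1) by blast
  then show False
    using assms(4) by (simp add: u'_def)
qed

text \<open>A criterion for an idempotent \<open>a\<close> of an algebra with unit \<open>e\<close> to be a primitive axis of Monster
  type whose \<open>0\<close>-eigenspace is spanned by the complementary idempotent \<open>e - a\<close>. Products
  with multiples of \<open>a\<close> and of \<open>e - a\<close> obey the fusion law automatically, so only the products
  inside \<open>W + G\<close> have to be checked, where \<open>W\<close> and \<open>G\<close> are the eigenspaces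
  for \<open>\<alpha>\<close> and \<open>\<beta>\<close>.\<close>

lemma primitive_monster_axisI:
  assumes unit: "\<And>v. e \<bullet> v = v"
    and dist: "distinct [1, 0, \<alpha>, \<beta>]"
    and nz: "a \<noteq> 0" and idem: "a \<bullet> a = a"
    and eigW: "\<And>w. w \<in> W \<Longrightarrow> a \<bullet> w = \<alpha> *s w"
    and eigG: "\<And>g. g \<in> G \<Longrightarrow> a \<bullet> g = \<beta> *s g"
    and decomp: "\<And>v. \<exists>c d. \<exists>w\<in>W. \<exists>g\<in>G. v = c *s a + d *s (e - a) + w + g"
    and WW: "\<And>w w'. w \<in> W \<Longrightarrow> w' \<in> W \<Longrightarrow> w \<bullet> w' \<in> span {a, e - a}"
    and WG: "\<And>w g. w \<in> W \<Longrightarrow> g \<in> G \<Longrightarrow> w \<bullet> g \<in> G"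
    and GG: "\<And>g g'. g \<in> G \<Longrightarrow> g' \<in> G \<Longrightarrow> g \<bullet> g' \<in> span (insert a (insert (e - a) W))"
  shows "is_primitive_axis (monster_set \<alpha> \<beta>) (monster_star \<alpha> \<beta>) a"
proof -
  have ae: "a \<bullet> e = a"
    using unit by (metis mult_commute)
  have a0: "a \<bullet> (e - a) = 0"
    by (simp add: mult_diff_right ae idem)
  have in1: "c *s a \<in> eigenspace a 1" and in0: "c *s (e - a) \<in> eigenspace a 0" for c
    by (simp_all add: eigenspace_def mult_scale_right idem a0)
  have inW: "W \<subseteq> eigenspace a \<alpha>" and inG: "G \<subseteq> eigenspace a \<beta>"
    using eigW eigG by (auto simp: eigenspace_def)
  have indep: "p = 0 \<and> q = 0 \<and> r = 0 \<and> t = 0"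
    if "p \<in> eigenspace a 1" "q \<in> eigenspace a 0" "r \<in> eigenspace a \<alpha>" "t \<in> eigenspace a \<beta>"
      "p + q + r + t = 0" for p q r t
  proof -
    define u where "u = (\<lambda>_. 0)(1 := p, 0 := q, \<alpha> := r, \<beta> := t)"
    have u: "u 1 = p" "u 0 = q" "u \<alpha> = r" "u \<beta> = t"
      using dist by (auto simp: u_def)
    have "(\<Sum>\<nu>\<in>{1, 0, \<alpha>, \<beta>}. u \<nu>) = p + q + r + t"
      using dist by (simp add: u add.assoc)
    then have "\<forall>\<nu>\<in>{1, 0, \<alpha>, \<beta>}. u \<nu> = 0"
      using that by (intro eigenvectors_independent) (auto simp: u)
    then show ?thesis
      by (simp add: u)
  qed
  have E1: "eigenspace a 1 = range (\<lambda>c. c *s a)"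
  proof (intro equalityI subsetI)
    fix v assume v: "v \<in> eigenspace a 1"
    obtain c d w g where d: "w \<in> W" "g \<in> G" "v = c *s a + d *s (e - a) + w + g"
      using decomp by metis
    then have "(c *s a - v) + d *s (e - a) + w + g = 0"
      by (simp add: algebra_simps)
    then have "c *s a - v = 0"
      using indep[OF subspace_diff[OF subspace_eigenspace in1 v] in0] d inW inG by blast
    then show "v \<in> range (\<lambda>c. c *s a)"
      by auto
  qed (use in1 in auto)
  have E0: "eigenspace a 0 = range (\<lambda>c. c *s (e - a))"
  proof (intro equalityI subsetI)
    fix v assume v: "v \<in> eigenspace a 0"
    obtain c d w g where d: "w \<in> W" "g \<in> G" "v = c *s a + d *s (e - a) + w + g"
      using decomp by metis
    then have "c *s a + (d *s (e - a) - v) + w + g = 0"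
      by (simp add: algebra_simps)
    then have "d *s (e - a) - v = 0"
      using indep[OF in1 subspace_diff[OF subspace_eigenspace in0 v]] d inW inG by blast
    then show "v \<in> range (\<lambda>c. c *s (e - a))"
      by auto
  qed (use in0 in auto)
  have EW: "eigenspace a \<alpha> = W"
  proof (intro equalityI subsetI)
    fix v assume v: "v \<in> eigenspace a \<alpha>"
    obtain c d w g where d: "w \<in> W" "g \<in> G" "v = c *s a + d *s (e - a) + w + g"
      using decomp by metis
    then have "c *s a + d *s (e - a) + (w - v) + g = 0"
      by (simp add: algebra_simps)
    then have "w - v = 0"
      using indep[OF in1 in0 subspace_diff[OF subspace_eigenspace _ v]] d inW inG by blast
    then show "v \<in> W"
      using d(1) by simp
  qed (use inW in auto)
  have EG: "eigenspace a \<beta> = G"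
  proof (intro equalityI subsetI)
    fix v assume v: "v \<in> eigenspace a \<beta>"
    obtain c d w g where d: "w \<in> W" "g \<in> G" "v = c *s a + d *s (e - a) + w + g"
      using decomp by metis
    then have "c *s a + d *s (e - a) + w + (g - v) = 0"
      by (simp add: algebra_simps)
    then have "g - v = 0"
      using indep[OF in1 in0 _ subspace_diff[OF subspace_eigenspace _ v]] d inW inG by blast
    then show "v \<in> G"
      using d(2) by simp
  qed (use inG in auto)
  have "is_direct_sum (monster_set \<alpha> \<beta>) (eigenspace a)"
    unfolding is_direct_sum_def
  proof (intro conjI allI impI)
    show "span (\<Union>\<nu>\<in>monster_set \<alpha> \<beta>. eigenspace a \<nu>) = UNIV"
    proof (intro equalityI subsetI UNIV_I)
      fix v
      obtain c d w g where d: "w \<in> W" "g \<in> G" "v = c *s a + d *s (e - a) + w + g"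
        using decomp by metis
      have "x \<in> span (\<Union>\<nu>\<in>monster_set \<alpha> \<beta>. eigenspace a \<nu>)"
        if "x \<in> eigenspace a \<nu>" "\<nu> \<in> {1, 0, \<alpha>, \<beta>}" for x \<nu>
        using that by (intro span_base) (auto simp: monster_set_def)
      then show "v \<in> span (\<Union>\<nu>\<in>monster_set \<alpha> \<beta>. eigenspace a \<nu>)"
        unfolding d(3) using in1 in0 d inW inG by (intro span_add) blast+
    qed
  qed (use eigenvectors_independent in blast)
  moreover have "u \<bullet> v \<in> eigenspace_sum a (monster_star \<alpha> \<beta> x y)"
    if "x \<in> monster_set \<alpha> \<beta>" "y \<in> monster_set \<alpha> \<beta>" "u \<in> eigenspace a x" "v \<in> eigenspace a y"
    for x y u v
  proof -
    define P where "P x y \<longleftrightarrow> (\<forall>u\<in>eigenspace a x. \<forall>v\<in>eigenspace a y.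
      u \<bullet> v \<in> eigenspace_sum a (monster_star \<alpha> \<beta> x y))" for x y
    \<comment> \<open>Algebra and fusion law are commutative, so ten of the sixteen pairs suffice.\<close>
    have "monster_star \<alpha> \<beta> x y = monster_star \<alpha> \<beta> y x" for x y
      unfolding monster_star_def by (simp add: insert_commute)
    then have swap: "P y x" if "P x y" for x y
      using that mult_commute unfolding P_def by metis
    have sing: "x \<in> eigenspace_sum a {\<nu>}" if "x \<in> eigenspace a \<nu>" for x \<nu>
      using that by (simp add: eigenspace_sum_def span_base)
    have aux: "a \<bullet> v \<in> eigenspace a \<nu>" "(e - a) \<bullet> v \<in> eigenspace a \<nu>"
      if "v \<in> eigenspace a \<nu>" for v \<nu>
    proof -
      have av: "a \<bullet> v = \<nu> *s v"
        using that by (simp add: eigenspace_def)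
      then show "a \<bullet> v \<in> eigenspace a \<nu>"
        using subspace_scale[OF subspace_eigenspace that] by simp
      with that show "(e - a) \<bullet> v \<in> eigenspace a \<nu>"
        by (simp add: mult_diff_left unit subspace_diff[OF subspace_eigenspace])
    qed
    have P1: "P 1 \<nu>" if "monster_star \<alpha> \<beta> 1 \<nu> = {\<nu>}" for \<nu>
      using that aux subspace_scale[OF subspace_eigenspace]
      by (auto simp: P_def E1 mult_scale_left intro!: sing)
    have P0: "P 0 \<nu>" if "monster_star \<alpha> \<beta> 0 \<nu> = {\<nu>}" for \<nu>
      using that aux subspace_scale[OF subspace_eigenspace]
      by (auto simp: P_def E0 mult_scale_left intro!: sing)
    note table = monster_star_table[OF dist]
    have "P 1 1" "P 1 \<alpha>" "P 1 \<beta>" and "P 0 0" "P 0 \<alpha>" "P 0 \<beta>"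
      by (simp_all add: P1 P0 table)
    moreover have "P 1 0"
      by (auto simp: P_def E1 E0 mult_scale_left mult_scale_right a0 eigenspace_sum_def span_zero)
    moreover have "P \<alpha> \<alpha>"
    proof -
      have "{a, e - a} \<subseteq> (\<Union>\<nu>\<in>{1, 0}. eigenspace a \<nu>)"
        using in1[of 1] in0[of 1] by simp
      then show ?thesis
        using WW span_mono unfolding P_def EW table eigenspace_sum_def by blast
    qed
    moreover have "P \<alpha> \<beta>"
      using WG by (auto simp: P_def EW EG table intro!: sing)
    moreover have "P \<beta> \<beta>"
    proof -
      have "insert a (insert (e - a) W) \<subseteq> (\<Union>\<nu>\<in>{1, 0, \<alpha>}. eigenspace a \<nu>)"
        using in1[of 1] in0[of 1] inW by auto
      then show ?thesis
        using GG span_mono unfolding P_def EG table eigenspace_sum_def by blast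
    qed
    ultimately have "P x y"
      using that(1,2) swap[of 1 0] swap[of 1 \<alpha>] swap[of 1 \<beta>] swap[of 0 \<alpha>] swap[of 0 \<beta>]
        swap[of \<alpha> \<beta>]
      unfolding monster_set_def by (elim insertE emptyE) simp_all
    then show ?thesis
      using that(3,4) by (simp add: P_def)
  qed
  ultimately have "is_axis (monster_set \<alpha> \<beta>) (monster_star \<alpha> \<beta>) a"
    using nz idem by (simp add: is_axis_def)
  then show ?thesis
    by (simp add: is_primitive_axis_def E1 span_singleton)
qed

lemma subalgebra_hull_eq_UNIV_iff:
  "subalgebra hull X = UNIV \<longleftrightarrow> (\<forall>B. subalgebra B \<and> X \<subseteq> B \<longrightarrow> B = UNIV)"
  by (auto simp: hull_def)

end


section \<open>Idempotents and axes of the split spin factor\<close>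

text \<open>The standing assumptions on \<open>E\<close>, \<open>b\<close> and \<open>\<alpha>\<close>, except that \<open>E\<close> may be zero.\<close>

locale split_spin_factor = vector_space s
  for s :: "'a::field \<Rightarrow> 'e::ab_group_add \<Rightarrow> 'e" +
  fixes b :: "'e \<Rightarrow> 'e \<Rightarrow> 'a" and \<alpha> :: 'a
  assumes bilinear: "symmetric_bilinear s b"
    and alpha: "\<alpha> \<noteq> 0" "\<alpha> \<noteq> 1" "2 * \<alpha> \<noteq> 1"
begin

sublocale A: commutative_algebra "ssf_scale s" "ssf_mult s b \<alpha>"
  using vector_space_axioms bilinear by (rule commutative_algebra_ssf)

abbreviation ssf_scale_op (infixr \<open>\<cdot>\<close> 75) where "c \<cdot> v \<equiv> ssf_scale s c v"
abbreviation ssf_mult_op (infixl \<open>\<odot>\<close> 70) where "u \<odot> v \<equiv> ssf_mult s b \<alpha> u v"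

lemmas scale_eq [simp] = vector_space_ssf(2)[OF vector_space_axioms]

lemma mult_eq:
  "(e, x, y) \<odot> (f, x', y') = (s (\<alpha> * x' + (1 - \<alpha>) * y') e + s (\<alpha> * x + (1 - \<alpha>) * y) f,
     x * x' - b e f * (\<alpha> * (\<alpha> - 2)), y * y' - b e f * ((\<alpha> - 1) * (\<alpha> + 1)))"
  by (simp add: ssf_mult_def)

lemma b_sym: "b e f = b f e"
  using bilinear by (simp add: symmetric_bilinear_def)

lemma b_scale: "b (s c e) f = c * b e f" "b e (s c f) = c * b e f"
  using bilinear by (simp_all add: symmetric_bilinear_def Vector_Spaces.linear_iff)

lemma b_add: "b (e + e') f = b e f + b e' f"
  using bilinear by (simp add: symmetric_bilinear_def Vector_Spaces.linear_iff)

lemma b_minus: "b (- e) f = - b e f" "b f (- e) = - b f e"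
  using b_scale(1)[of "- 1" e f] b_scale(2)[of f "- 1" e] by simp_all

lemma b_zero [simp]: "b 0 f = 0" "b e 0 = 0"
  using b_scale(1)[of 0 0 f] b_scale(2)[of e 0 0] by simp_all

lemma b_diff: "b (e - e') f = b e f - b e' f"
  using b_add[of "e - e'" e' f] by simp

abbreviation z1 :: "'e \<times> 'a \<times> 'a" where "z1 \<equiv> (0, 1, 0)"

lemma unit_mult: "(0, 1, 1) \<odot> v = v"
  by (cases v) (simp add: mult_eq)

text \<open>The idempotent \<open>(f + \<alpha> z\<^sub>1 + (1 + \<alpha>) z\<^sub>2) / 2\<close> attached to a vector \<open>f\<close>
  with \<open>b f f = 1\<close>.\<close>

definition half_axis :: "'e \<Rightarrow> 'e \<times> 'a \<times> 'a" where
  "half_axis f = (s (1 / 2) f, \<alpha> / 2, (1 + \<alpha>) / 2)"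

context
  assumes two: "(2::'a) \<noteq> 0"
begin

text \<open>The powers of 2 that occur as denominators in the computations below.\<close>

lemma powers_of_two_neq_0: "(2::'a) \<noteq> 0" "(4::'a) \<noteq> 0" "(8::'a) \<noteq> 0" "(16::'a) \<noteq> 0"
  "(128::'a) \<noteq> 0" "(512::'a) \<noteq> 0"
  using two power_not_zero[OF two, of 2] power_not_zero[OF two, of 3] power_not_zero[OF two, of 4]
    power_not_zero[OF two, of 7] power_not_zero[OF two, of 9]
  by simp_all

lemma distinct_eigenvalues: "distinct [1, 0, \<alpha>, 1 / 2]"
proof -
  have "(1::'a) \<noteq> 1 / 2"
    using two by (metis add_cancel_right_left divide_eq_1_iff eq_divide_eq_1 mult_cancel_right1
        one_add_one one_neq_zero)
  moreover have "\<alpha> \<noteq> 1 / 2"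
    using alpha(3) two by (auto simp: field_simps)
  ultimately show ?thesis
    using alpha two by simp
qed

lemma primitive_axis_z1:
  "A.is_primitive_axis (monster_set \<alpha> (1 / 2)) (monster_star \<alpha> (1 / 2)) z1"
proof (rule A.primitive_monster_axisI[where e = "(0, 1, 1)" and W = "{(e, 0, 0) |e. True}"
      and G = "{0}"])
  show "distinct [1, 0, \<alpha>, 1 / 2]"
    by (rule distinct_eigenvalues)
  show "\<exists>c d. \<exists>w\<in>{(e, 0, 0) |e. True}. \<exists>g\<in>{0}.
      v = c \<cdot> z1 + d \<cdot> ((0, 1, 1) - z1) + w + g" for v
  proof -
    obtain e x y where "v = (e, x, y)"
      by (cases v)
    then show ?thesis
      by (intro exI[of _ x] exI[of _ y] bexI[of _ "(e, 0, 0)"] bexI[of _ 0])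
        (auto simp: zero_prod_def)
  qed
  show "w \<odot> w' \<in> A.span {z1, (0, 1, 1) - z1}"
    if w: "w \<in> {(e, 0, 0) |e. True}" "w' \<in> {(e, 0, 0) |e. True}" for w w'
  proof -
    obtain e e' where "w = (e, 0, 0)" "w' = (e', 0, 0)"
      using w by blast
    then have "w \<odot> w' = (- b e e' * (\<alpha> * (\<alpha> - 2))) \<cdot> z1
        + (- b e e' * ((\<alpha> - 1) * (\<alpha> + 1))) \<cdot> ((0, 1, 1) - z1)"
      by (simp add: mult_eq)
    then show ?thesis
      by (simp only:) (intro A.span_add A.span_scale A.span_base; simp)
  qed
  show "g \<odot> g' \<in> A.span (insert z1 (insert ((0, 1, 1) - z1) {(e, 0, 0) |e. True}))"
    if "g \<in> {0}" "g' \<in> {0}" for g g'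
    using that by (simp add: A.span_zero)
qed (auto simp: unit_mult mult_eq zero_prod_def)

text \<open>An \<open>\<alpha>\<close>-eigenvector of \<open>half_axis f\<close> when \<open>b f f = 1\<close>.\<close>

definition alpha_vector :: "'e \<Rightarrow> 'e \<times> 'a \<times> 'a" where
  "alpha_vector f = (- f, \<alpha> - 2, \<alpha> + 1)"

lemma half_axis_alpha_vector:
  assumes "b f f = 1"
  shows "half_axis f \<odot> alpha_vector f = \<alpha> \<cdot> alpha_vector f"
proof -
  have neg: "b (s (1 / 2) f) (- f) = - (1 / 2)"
    using assms by (simp add: b_scale b_minus)
  have "s (\<alpha> * (\<alpha> - 2) + (1 - \<alpha>) * (\<alpha> + 1)) (s (1 / 2) f)
      + s (\<alpha> * (\<alpha> / 2) + (1 - \<alpha>) * ((1 + \<alpha>) / 2)) (- f)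
      = s ((\<alpha> * (\<alpha> - 2) + (1 - \<alpha>) * (\<alpha> + 1)) * (1 / 2)
        - (\<alpha> * (\<alpha> / 2) + (1 - \<alpha>) * ((1 + \<alpha>) / 2))) f"
    by (simp only: scale_left_diff_distrib scale_scale scale_minus_right) simp
  also have "(\<alpha> * (\<alpha> - 2) + (1 - \<alpha>) * (\<alpha> + 1)) * (1 / 2)
        - (\<alpha> * (\<alpha> / 2) + (1 - \<alpha>) * ((1 + \<alpha>) / 2)) = - \<alpha>"
    using powers_of_two_neq_0 by (simp add: field_simps)
  also have "s (- \<alpha>) f = s \<alpha> (- f)"
    by simp
  finally have E: "s (\<alpha> * (\<alpha> - 2) + (1 - \<alpha>) * (\<alpha> + 1)) (s (1 / 2) f)
      + s (\<alpha> * (\<alpha> / 2) + (1 - \<alpha>) * ((1 + \<alpha>) / 2)) (- f) = s \<alpha> (- f)" .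
  have "\<alpha> / 2 * (\<alpha> - 2) - - (1 / 2) * (\<alpha> * (\<alpha> - 2)) = \<alpha> * (\<alpha> - 2)"
    "(1 + \<alpha>) / 2 * (\<alpha> + 1) - - (1 / 2) * ((\<alpha> - 1) * (\<alpha> + 1)) = \<alpha> * (\<alpha> + 1)"
    using powers_of_two_neq_0 by (simp_all add: field_simps)
  with E show ?thesis
    by (simp only: half_axis_def alpha_vector_def mult_eq neg scale_eq)
qed

text \<open>Eigenvectors for \<open>1\<close>, \<open>0\<close> and \<open>\<alpha>\<close> span the same subspace as \<open>f\<close>, \<open>z\<^sub>1\<close> and \<open>z\<^sub>2\<close>. The
  identity does not need \<open>b f f = 1\<close>.\<close>

lemma half_axis_coordinates:
  "(s c f, x, y) =
     (\<alpha> / 2 * x + (1 - \<alpha> / 2) * y + (1 - \<alpha> / 2) * c) \<cdot> half_axis f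
     + ((\<alpha> + 1) / 2 * x + (1 - \<alpha>) / 2 * y - (\<alpha> + 1) / 2 * c) \<cdot> ((0, 1, 1) - half_axis f)
     + ((y - x - c) / 4) \<cdot> alpha_vector f"
  (is "_ = ?l \<cdot> _ + ?m \<cdot> _ + ?k \<cdot> _")
proof -
  have "c = ?l * (1 / 2) - ?m * (1 / 2) - ?k"
    using powers_of_two_neq_0 by (simp add: field_simps)
  then have "s c f = s (?l * (1 / 2)) f - s (?m * (1 / 2)) f - s ?k f"
    by (metis scale_left_diff_distrib)
  moreover have "x = ?l * (\<alpha> / 2) + ?m * (1 - \<alpha> / 2) + ?k * (\<alpha> - 2)"
    using powers_of_two_neq_0 by (simp add: field_simps)
  moreover have "y = ?l * ((1 + \<alpha>) / 2) + ?m * (1 - (1 + \<alpha>) / 2) + ?k * (\<alpha> + 1)"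
    using powers_of_two_neq_0 by (simp add: field_simps)
  ultimately show ?thesis
    unfolding half_axis_def alpha_vector_def
    by (simp only: scale_eq scale_scale add_Pair diff_Pair prod.inject diff_0 scale_minus_right)
      simp
qed

text \<open>The \<open>1/2\<close>-eigenspace of \<open>half_axis f\<close> is the orthogonal complement of \<open>f\<close> in \<open>E\<close>.\<close>

lemma primitive_axis_half_axis:
  assumes f: "b f f = 1"
  shows "A.is_primitive_axis (monster_set \<alpha> (1 / 2)) (monster_star \<alpha> (1 / 2)) (half_axis f)"
proof (rule A.primitive_monster_axisI[where e = "(0, 1, 1)"
      and W = "range (\<lambda>c. c \<cdot> alpha_vector f)" and G = "{(g, 0, 0) |g. b g f = 0}"])
  let ?a = "half_axis f"
  let ?w = "alpha_vector f"
  have bff: "b (- f) (- f) = 1"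
    using f by (simp add: b_minus)
  show "(0, 1, 1) \<odot> v = v" for v
    by (rule unit_mult)
  show "distinct [1, 0, \<alpha>, 1 / 2]"
    by (rule distinct_eigenvalues)
  show "?a \<noteq> 0"
    using f two by (auto simp: half_axis_def zero_prod_def)
  show "?a \<odot> ?a = ?a"
  proof -
    have "\<alpha> * (\<alpha> / 2) + (1 - \<alpha>) * ((1 + \<alpha>) / 2) = 1 / 2"
      using powers_of_two_neq_0 by (simp add: field_simps)
    moreover have "s (1 / 2) (s (1 / 2) f) + s (1 / 2) (s (1 / 2) f) = s (1 / 2) f"
      using powers_of_two_neq_0
      by (simp only: scale_scale flip: scale_left_distrib) (simp add: field_simps)
    moreover have "b (s (1 / 2) f) (s (1 / 2) f) = 1 / 4"
      by (simp add: b_scale f)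
    moreover have "\<alpha> / 2 * (\<alpha> / 2) - 1 / 4 * (\<alpha> * (\<alpha> - 2)) = \<alpha> / 2"
      "(1 + \<alpha>) / 2 * ((1 + \<alpha>) / 2) - 1 / 4 * ((\<alpha> - 1) * (\<alpha> + 1)) = (1 + \<alpha>) / 2"
      using powers_of_two_neq_0 by (simp_all add: field_simps)
    ultimately show ?thesis
      by (simp only: half_axis_def mult_eq)
  qed
  show "?a \<odot> w = \<alpha> \<cdot> w" if "w \<in> range (\<lambda>c. c \<cdot> ?w)" for w
    using that half_axis_alpha_vector[OF f]
    by (auto simp: A.mult_scale_right A.scale_scale mult.commute)
  show "?a \<odot> g = (1 / 2) \<cdot> g" if "g \<in> {(g, 0, 0) |g. b g f = 0}" for g
  proof -
    have "\<alpha> * (\<alpha> / 2) + (1 - \<alpha>) * ((1 + \<alpha>) / 2) = 1 / 2"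
      using powers_of_two_neq_0 by (simp add: field_simps)
    then show ?thesis
      using that b_sym[of f] by (auto simp: half_axis_def mult_eq b_scale)
  qed
  show "\<exists>c d. \<exists>w\<in>range (\<lambda>c. c \<cdot> ?w). \<exists>g\<in>{(g, 0, 0) |g. b g f = 0}.
      v = c \<cdot> ?a + d \<cdot> ((0, 1, 1) - ?a) + w + g" for v
  proof -
    obtain e x y where v: "v = (e, x, y)"
      by (cases v)
    \<comment> \<open>Since \<open>b f f = 1\<close>, the orthogonal projection of \<open>e\<close> to the line of \<open>f\<close>
      is \<open>b e f\<close> times \<open>f\<close>.\<close>
    have "v = (s (b e f) f, x, y) + (e - s (b e f) f, 0, 0)"
      by (simp add: v)
    moreover have "b (e - s (b e f) f) f = 0"
      by (simp add: b_diff b_scale f)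
    ultimately show ?thesis
      unfolding half_axis_coordinates[of "b e f" f x y] by blast
  qed
  show "w \<odot> w' \<in> A.span {?a, (0, 1, 1) - ?a}"
    if w: "w \<in> range (\<lambda>c. c \<cdot> ?w)" "w' \<in> range (\<lambda>c. c \<cdot> ?w)" for w w'
  proof -
    have "?w \<odot> ?w = (- 4 * (1 - 2 * \<alpha>)) \<cdot> ?a + (4 * (1 - \<alpha> * \<alpha>)) \<cdot> (0, 1, 1)"
    proof -
      have "\<alpha> * (\<alpha> - 2) + (1 - \<alpha>) * (\<alpha> + 1) = 1 - 2 * \<alpha>"
        by (simp add: algebra_simps)
      moreover have "s (1 - 2 * \<alpha>) (- f) + s (1 - 2 * \<alpha>) (- f)
          = s (- 4 * (1 - 2 * \<alpha>)) (s (1 / 2) f)"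
      proof -
        have "- 4 * (1 - 2 * \<alpha>) * (1 / 2) = - (1 - 2 * \<alpha>) + - (1 - 2 * \<alpha>)"
          using powers_of_two_neq_0 by (simp add: field_simps)
        then show ?thesis
          by (simp only: scale_scale scale_left_distrib scale_minus_left scale_minus_right)
      qed
      moreover have "(\<alpha> - 2) * (\<alpha> - 2) - \<alpha> * (\<alpha> - 2)
          = - 4 * (1 - 2 * \<alpha>) * (\<alpha> / 2) + 4 * (1 - \<alpha> * \<alpha>)"
        "(\<alpha> + 1) * (\<alpha> + 1) - (\<alpha> - 1) * (\<alpha> + 1)
          = - 4 * (1 - 2 * \<alpha>) * ((1 + \<alpha>) / 2) + 4 * (1 - \<alpha> * \<alpha>)"
        using powers_of_two_neq_0 by (simp_all add: field_simps)
      ultimately show ?thesis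
        by (simp only: half_axis_def alpha_vector_def mult_eq scale_eq add_Pair bff) simp
    qed
    also have "(0, 1, 1) = ?a + ((0, 1, 1) - ?a)"
      by simp
    finally have "?w \<odot> ?w \<in> A.span {?a, (0, 1, 1) - ?a}"
      by (simp only:) (intro A.span_add A.span_scale A.span_base; simp)
    then show ?thesis
      using w by (auto simp: A.mult_scale_right A.mult_scale_left intro!: A.span_scale)
  qed
  show "w \<odot> g \<in> {(g, 0, 0) |g. b g f = 0}"
    if "w \<in> range (\<lambda>c. c \<cdot> ?w)" "g \<in> {(g, 0, 0) |g. b g f = 0}" for w g
    using that b_sym[of f] by (auto simp: alpha_vector_def mult_eq b_scale b_minus)
  show "g \<odot> g' \<in> A.span (insert ?a (insert ((0, 1, 1) - ?a) (range (\<lambda>c. c \<cdot> ?w))))"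
    if "g \<in> {(g, 0, 0) |g. b g f = 0}" "g' \<in> {(g, 0, 0) |g. b g f = 0}" for g g'
  proof -
    let ?S = "A.span (insert ?a (insert ((0, 1, 1) - ?a) (range (\<lambda>c. c \<cdot> ?w))))"
    have "c \<cdot> ?a \<in> ?S" "c \<cdot> ((0, 1, 1) - ?a) \<in> ?S" "c \<cdot> ?w \<in> ?S" for c
      by (blast intro: A.span_scale A.span_base)+
    then have "(s 0 f, x, y) \<in> ?S" for x y
      unfolding half_axis_coordinates[of 0 f x y] by (intro A.span_add)
    then have "(0, x, y) \<in> ?S" for x y
      by (metis scale_zero_left)
    moreover have "fst (g \<odot> g') = 0"
      using that by (auto simp: mult_eq)
    ultimately show ?thesis
      by (metis prod.collapse)
  qed
qed

text \<open>The component of the idempotent equation in \<open>E\<close> puts \<open>(x, y)\<close> on a line through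
  \<open>(1/2, 1/2)\<close>. With \<open>t = x - y\<close> as a parameter of that line, the other two components force first
  \<open>b e e = t\<^sup>2\<close> and then \<open>t = 1/2\<close> or \<open>t = - 1/2\<close>.\<close>

lemma idempotent_cases:
  assumes idem: "(e, x, y) \<odot> (e, x, y) = (e, x, y)" and "e \<noteq> 0"
  shows "\<exists>f. b f f = 1 \<and> ((e, x, y) = half_axis f \<or> (e, x, y) = (0, 1, 1) - half_axis f)"
proof -
  define \<beta> t where "\<beta> = b e e" and "t = x - y"
  have eqs: "s (\<alpha> * x + (1 - \<alpha>) * y) e + s (\<alpha> * x + (1 - \<alpha>) * y) e = e"
    "x * x - \<beta> * (\<alpha> * (\<alpha> - 2)) = x" "y * y - \<beta> * ((\<alpha> - 1) * (\<alpha> + 1)) = y"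
    using idem by (simp_all add: mult_eq \<beta>_def)
  have "s (2 * (\<alpha> * x + (1 - \<alpha>) * y)) e = s 1 e"
    using eqs(1) by (simp only: mult_2 scale_left_distrib scale_one)
  then have lin: "2 * (\<alpha> * x + (1 - \<alpha>) * y) = 1"
    using \<open>e \<noteq> 0\<close> by (metis scale_right_imp_eq)
  have x: "2 * x = 1 + 2 * (1 - \<alpha>) * t" and y: "2 * y = 1 - 2 * \<alpha> * t"
    using lin by (simp_all add: t_def algebra_simps)
  have "4 * ((1 - 2 * \<alpha>) * (t * t - \<beta>)) = 0"
  proof -
    have "\<beta> * (\<alpha> * (\<alpha> - 2)) = x * x - x" "\<beta> * ((\<alpha> - 1) * (\<alpha> + 1)) = y * y - y"
      using eqs(2,3) by (simp_all add: algebra_simps)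
    moreover have "\<beta> * (1 - 2 * \<alpha>) = \<beta> * (\<alpha> * (\<alpha> - 2)) - \<beta> * ((\<alpha> - 1) * (\<alpha> + 1))"
      by (simp add: algebra_simps)
    ultimately have "4 * (\<beta> * (1 - 2 * \<alpha>)) = 4 * (x * x - x) - 4 * (y * y - y)"
      by (simp only: right_diff_distrib)
    also have "\<dots> = 2 * x * (2 * x) - 2 * (2 * x) - (2 * y * (2 * y) - 2 * (2 * y))"
      by (simp add: algebra_simps)
    also have "\<dots> = 4 * (1 - 2 * \<alpha>) * (t * t)"
      unfolding x y by (simp add: algebra_simps)
    finally show ?thesis
      by (simp add: algebra_simps)
  qed
  then have \<beta>: "\<beta> = t * t"
    using powers_of_two_neq_0 alpha(3) by auto
  have "(2 * t - 1) * (2 * t + 1) = 0"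
  proof -
    have "y * y - y = t * t * ((\<alpha> - 1) * (\<alpha> + 1))"
      using eqs(3) \<beta> by (simp add: algebra_simps)
    moreover have "4 * (y * y - y) = 2 * y * (2 * y) - 2 * (2 * y)"
      by (simp add: algebra_simps)
    ultimately have "2 * y * (2 * y) - 2 * (2 * y) = 4 * (t * t * ((\<alpha> - 1) * (\<alpha> + 1)))"
      by metis
    then show ?thesis
      unfolding y by (simp add: algebra_simps)
  qed
  then consider "2 * t = 1" | "2 * t = - 1"
    by (auto simp: eq_neg_iff_add_eq_0)
  then show ?thesis
  proof cases
    case 1
    have "b (s (- 2) e) (s (- 2) e) = 2 * t * (2 * t)"
      using \<beta> by (simp add: b_scale b_minus \<beta>_def)
    then have "b (s (- 2) e) (s (- 2) e) = 1"
      unfolding 1 by simp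
    moreover have "x = 1 - \<alpha> / 2" "y = 1 - (1 + \<alpha>) / 2"
      using x y 1 two by (simp_all add: field_simps)
    then have "(e, x, y) = (0, 1, 1) - half_axis (s (- 2) e)"
      using two by (simp add: half_axis_def)
    ultimately show ?thesis by blast
  next
    case 2
    have "b (s 2 e) (s 2 e) = 2 * t * (2 * t)"
      using \<beta> by (simp add: b_scale b_minus \<beta>_def)
    then have "b (s 2 e) (s 2 e) = 1"
      unfolding 2 by simp
    moreover have "x = \<alpha> / 2" "y = (1 + \<alpha>) / 2"
      using x y 2 two by (simp_all add: field_simps)
    then have "(e, x, y) = half_axis (s 2 e)"
      using two by (simp add: half_axis_def)
    ultimately show ?thesis by blast
  qed
qed

text \<open>The idempotents \<open>z\<^sub>2\<close> and \<open>1 - half_axis f\<close> have the eigenvalue \<open>1 - \<alpha>\<close>, which is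
  excluded, and the unit is not primitive.\<close>

lemma primitive_axis_cases:
  assumes "\<exists>e::'e. e \<noteq> 0"
    and prim: "A.is_primitive_axis (monster_set \<alpha> (1 / 2)) (monster_star \<alpha> (1 / 2)) a"
  shows "a = z1 \<or> (\<exists>f. b f f = 1 \<and> a = half_axis f)"
proof -
  have axis: "A.is_axis (monster_set \<alpha> (1 / 2)) (monster_star \<alpha> (1 / 2)) a"
    and line: "A.eigenspace a 1 = A.span {a}"
    using prim by (simp_all add: A.is_primitive_axis_def)
  have idem: "a \<odot> a = a" and "a \<noteq> 0"
    using axis by (simp_all add: A.is_axis_def)
  have "1 - \<alpha> \<notin> monster_set \<alpha> (1 / 2)"
    using alpha two by (auto simp: monster_set_def field_simps)
  then have no: "v = 0" if "a \<odot> v = (1 - \<alpha>) \<cdot> v" for v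
    using A.axis_eigenvalue_mem[OF _ axis that] by (auto simp: monster_set_def)
  obtain e x y where a: "a = (e, x, y)"
    by (cases a)
  show ?thesis
  proof (cases "e = 0")
    case True
    then have xy: "x \<in> {0, 1}" "y \<in> {0, 1}"
      using idem by (auto simp: a mult_eq)
    obtain e' :: 'e where "e' \<noteq> 0"
      using assms(1) by blast
    have "\<not> (x = 0 \<and> y = 1)"
    proof
      assume "x = 0 \<and> y = 1"
      then have "a \<odot> (e', 0, 0) = (1 - \<alpha>) \<cdot> (e', 0, 0)"
        using True by (simp add: a mult_eq)
      then have "(e', 0, 0) = (0 :: 'e \<times> 'a \<times> 'a)"
        by (rule no)
      then show False
        using \<open>e' \<noteq> 0\<close> by (simp add: zero_prod_def)
    qed
    moreover have "\<not> (x = 1 \<and> y = 1)"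
    proof
      assume "x = 1 \<and> y = 1"
      then have "z1 \<in> A.eigenspace a 1"
        using True unit_mult by (simp add: a A.eigenspace_def)
      then show False
        using True \<open>x = 1 \<and> y = 1\<close> unfolding line by (auto simp: A.span_singleton a)
    qed
    ultimately show ?thesis
      using xy True \<open>a \<noteq> 0\<close> by (auto simp: a zero_prod_def)
  next
    case False
    then obtain f where f: "b f f = 1" "a = half_axis f \<or> a = (0, 1, 1) - half_axis f"
      using idempotent_cases idem a by metis
    have "a \<noteq> (0, 1, 1) - half_axis f"
    proof
      assume "a = (0, 1, 1) - half_axis f"
      then have "a \<odot> alpha_vector f = (1 - \<alpha>) \<cdot> alpha_vector f"
        by (simp only: A.mult_diff_left unit_mult half_axis_alpha_vector[OF f(1)]
            A.scale_left_diff_distrib A.scale_one)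
      then have "alpha_vector f = 0"
        by (rule no)
      then have "f = 0"
        by (simp add: alpha_vector_def zero_prod_def)
      then show False
        using f(1) by simp
    qed
    then show ?thesis
      using f by blast
  qed
qed


section \<open>Generation by axes\<close>

lemma generated_imp_spanned:
  assumes "\<exists>e::'e. e \<noteq> 0"
    and gen: "A.is_primitive_axial_algebra (monster_set \<alpha> (1 / 2)) (monster_star \<alpha> (1 / 2))"
  shows "\<alpha> \<noteq> - 1" and "span {e. b e e = 1} = UNIV"
proof -
  obtain X where X: "\<And>a. a \<in> X \<Longrightarrow> a = z1 \<or> (\<exists>f. b f f = 1 \<and> a = half_axis f)"
    and hull: "\<And>B. A.subalgebra B \<Longrightarrow> X \<subseteq> B \<Longrightarrow> B = UNIV"
    using gen primitive_axis_cases[OF assms(1)]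
    unfolding A.is_primitive_axial_algebra_def A.subalgebra_hull_eq_UNIV_iff by metis
  show "\<alpha> \<noteq> - 1"
  proof
    assume m1: "\<alpha> = - 1"
    \<comment> \<open>In this case \<open>E\<close> multiplies into \<open>\<langle>z\<^sub>1\<rangle>\<close>, so \<open>E + \<langle>z\<^sub>1\<rangle>\<close> is a subalgebra.
      It contains all axes.\<close>
    define B :: "('e \<times> 'a \<times> 'a) set" where "B = {(e, x, 0) |e x. True}"
    have "A.subalgebra B"
      unfolding B_def A.subalgebra_def A.subspace_def
      by (auto simp: zero_prod_def ssf_mult_def m1)
    moreover have "X \<subseteq> B"
    proof
      fix a assume "a \<in> X"
      from X[OF this] show "a \<in> B"
        unfolding B_def half_axis_def by (auto simp: m1)
    qed
    ultimately have "(0, 0, 1) \<in> B"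
      using hull by blast
    then show False
      by (simp add: B_def)
  qed
  show "span {e. b e e = 1} = UNIV"
  proof -
    define B :: "('e \<times> 'a \<times> 'a) set" where "B = span {e. b e e = 1} \<times> UNIV"
    have "A.subalgebra B"
      by (auto simp: B_def A.subalgebra_def A.subspace_def zero_prod_def mult_eq
          intro: span_add span_scale span_zero)
    moreover have "X \<subseteq> B"
    proof
      fix a assume "a \<in> X"
      from X[OF this] show "a \<in> B"
        by (auto simp: B_def half_axis_def span_zero intro: span_scale span_base)
    qed
    ultimately have "B = UNIV"
      using hull by blast
    then show ?thesis
      by (auto simp: B_def)
  qed
qed

lemma spanned_imp_generated:
  assumes "\<exists>e::'e. e \<noteq> 0" and "\<alpha> \<noteq> - 1" and spn: "span {e. b e e = 1} = UNIV"
  shows "A.is_primitive_axial_algebra (monster_set \<alpha> (1 / 2)) (monster_star \<alpha> (1 / 2))"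
proof -
  define X where "X = insert z1 (half_axis ` {f. b f f = 1})"
  have "B = UNIV" if B: "A.subalgebra B" "X \<subseteq> B" for B
  proof -
    have sub: "A.subspace B" and mul: "\<And>u v. u \<in> B \<Longrightarrow> v \<in> B \<Longrightarrow> u \<odot> v \<in> B"
      using B(1) by (simp_all add: A.subalgebra_def)
    have z1: "z1 \<in> B"
      using B(2) by (simp add: X_def)
    have half: "half_axis f \<in> B" if "b f f = 1" for f
      using that B(2) by (auto simp: X_def)
    have unitvec: "(f, 0, 0) \<in> B" if "b f f = 1" for f
    proof -
      have "z1 \<odot> half_axis f - (\<alpha> / 2) \<cdot> z1 \<in> B"
        by (intro A.subspace_diff A.subspace_scale mul sub z1 half that)
      also have "z1 \<odot> half_axis f - (\<alpha> / 2) \<cdot> z1 = (s (\<alpha> / 2) f, 0, 0)"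
        by (simp add: half_axis_def mult_eq zero_prod_def)
      finally have "(2 / \<alpha>) \<cdot> (s (\<alpha> / 2) f, 0, 0) \<in> B"
        by (rule A.subspace_scale[OF sub])
      then show ?thesis
        using alpha(1) two by simp
    qed
    have "subspace {e. (e, 0, 0) \<in> B}"
    proof (rule subspaceI)
      show "0 \<in> {e. (e, 0, 0) \<in> B}"
        using A.subspace_0[OF sub] by (simp add: zero_prod_def)
      show "e + e' \<in> {e. (e, 0, 0) \<in> B}"
        if "e \<in> {e. (e, 0, 0) \<in> B}" "e' \<in> {e. (e, 0, 0) \<in> B}" for e e'
        using A.subspace_add[OF sub, of "(e, 0, 0)" "(e', 0, 0)"] that by simp
      show "s c e \<in> {e. (e, 0, 0) \<in> B}" if "e \<in> {e. (e, 0, 0) \<in> B}" for c e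
        using A.subspace_scale[OF sub, of "(e, 0, 0)" c] that by simp
    qed
    then have "span {e. b e e = 1} \<subseteq> {e. (e, 0, 0) \<in> B}"
      using unitvec by (intro span_minimal) auto
    then have E: "(e, 0, 0) \<in> B" for e
      using spn by auto
    have "{e. b e e = 1} \<noteq> {}"
      using spn assms(1) by (metis UNIV_I span_empty singletonD)
    then obtain f where f: "b f f = 1"
      by blast
    have "half_axis f - (s (1 / 2) f, 0, 0) - (\<alpha> / 2) \<cdot> z1 \<in> B"
      by (intro A.subspace_diff A.subspace_scale sub z1 half f E)
    also have "half_axis f - (s (1 / 2) f, 0, 0) - (\<alpha> / 2) \<cdot> z1 = (0, 0, (1 + \<alpha>) / 2)"
      by (simp add: half_axis_def)
    finally have "(1 / ((1 + \<alpha>) / 2)) \<cdot> (0, 0, (1 + \<alpha>) / 2) \<in> B"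
      by (rule A.subspace_scale[OF sub])
    moreover have "1 / c * c = 1" if "c \<noteq> 0" for c :: 'a
      using that by simp
    moreover have "(1 + \<alpha>) / 2 \<noteq> 0"
      using assms(2) two by (simp add: add_eq_0_iff)
    ultimately have z2: "(0, 0, 1) \<in> B"
      by (simp only: scale_eq scale_zero_right mult_zero_right not_False_eq_True)
    have "(e, x, y) \<in> B" for e x y
    proof -
      have "(e, 0, 0) + x \<cdot> z1 + y \<cdot> (0, 0, 1) \<in> B"
        by (intro A.subspace_add A.subspace_scale sub z1 z2 E)
      then show ?thesis
        by simp
    qed
    then show ?thesis
      by auto
  qed
  moreover have "A.is_primitive_axis (monster_set \<alpha> (1 / 2)) (monster_star \<alpha> (1 / 2)) a"
    if "a \<in> X" for a
    using that primitive_axis_z1 primitive_axis_half_axis by (auto simp: X_def)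
  ultimately show ?thesis
    unfolding A.is_primitive_axial_algebra_def A.subalgebra_hull_eq_UNIV_iff by blast
qed

end

end

lemma CHAR_neq_2_iff: "CHAR('a::field) \<noteq> 2 \<longleftrightarrow> (2::'a) \<noteq> 0"
proof -
  have "(2::'a) = 0 \<longleftrightarrow> CHAR('a) dvd 2"
    using of_nat_eq_0_iff_char_dvd[of 2, where 'a = 'a] by simp
  also have "\<dots> \<longleftrightarrow> CHAR('a) = 2"
  proof
    assume "CHAR('a) dvd 2"
    then have "CHAR('a) \<le> 2" "CHAR('a) \<noteq> 0"
      by (simp add: dvd_imp_le) (metis \<open>CHAR('a) dvd 2\<close> dvd_0_left_iff zero_neq_numeral)
    moreover have "CHAR('a) \<noteq> 1"
      by simp
    ultimately show "CHAR('a) = 2"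
      by linarith
  qed simp
  finally show ?thesis
    by simp
qed

theorem theorem3p9:
  fixes s :: "'a::field \<Rightarrow> 'e::ab_group_add \<Rightarrow> 'e"
    and b :: "'e \<Rightarrow> 'e \<Rightarrow> 'a"
    and \<alpha> :: 'a
  assumes "vector_space s"
    and "\<exists>e::'e. e \<noteq> 0"
    and "symmetric_bilinear s b"
    and "\<alpha> \<notin> {0, 1}"
    and "2 * \<alpha> \<noteq> 1"
  shows "commutative_algebra.is_primitive_axial_algebra_of_monster_type
           (ssf_scale s) (ssf_mult s b \<alpha>) \<alpha> (1 / 2)
         \<longleftrightarrow> CHAR('a) \<noteq> 2 \<and> \<alpha> \<noteq> -1 \<and> module.span s {e. b e e = 1} = UNIV"
proof -
  interpret split_spin_factor s b \<alpha>
    using assms by (simp add: split_spin_factor_def split_spin_factor_axioms_def)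
  have "(2::'a) \<noteq> 0" if "distinct [1, 0, \<alpha>, 1 / 2]"
    using that by auto
  then show ?thesis
    unfolding A.is_primitive_axial_algebra_of_monster_type_def CHAR_neq_2_iff
    using distinct_eigenvalues generated_imp_spanned spanned_imp_generated assms(2) by blast
qed

end
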